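(* Let $F$ be a clause-set with all clauses of length $1$ or $2$, and $L$ a linear order on the literals of $F$. The procedure which, for each unit-clause $\{x\}\in F$ in order $L$ (of $x$), runs $\mathrm{enum}(F,\{x\},L)$ and then removes $\{x\}$ from $F$, enumerates the set of all minimally unsatisfiable subsets of (the original) $F$ containing at least one unit-clause, in $L$-pathlex order.
   Context: Literals are variables and complements; clauses are finite sets of literals without complementary pair; clause-sets are finite sets of clauses; minimally unsatisfiable = unsatisfiable but removing any clause makes it satisfiable. The implication digraph $G=\mathrm{idg}(F)$ has vertex set all literals whose variable occurs in $F$; binary clause $\{a,b\}$ yields arcs $(\overline a,b),(\overline b,a)$; unit-clause $\{a\}$ yields arc $(\overline a,a)$, arcs of form $(a,\overline a)$ are units. $\mathcal{CL}(A)=\{\{\overline a,b\}:(a,b)\in A\}$. Paths have distinct vertices; regular = no complementary pair among vertices; nearly regular = exactly one complementary pair and regular after removing the last vertex; $\mathfrak U_z(G)$ = nearly regular paths starting at $z$; $F(P)=\mathcal{CL}(E(P))\cup\{\{z\}\}$. Regular decomposition $P=P_0;P_1$ of nearly regular $P$ with last vertex $w$: split at the vertex $\overline w$. Contraposition $\overline Q$: replace arcs $(a,b)$ by $(\overline b,\overline a)$ in reversed order. $L$-pathlex order: paths compared lexicographically as words of literals ordered by $L$; for a minimally unsatisfiable subset $F'$ with a unit-clause, $x(F')$ is the $L$-smallest $z$ with $\{z\}\in F'$ (at most two candidates), $P(F')$ the lexicographically smaller of the (at most two) paths $P\in\mathfrak U_{x(F')}(G)$ with $F(P)=F'$, and $F'<_LF''$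 iff $P(F')<_LP(F'')$. Procedure $\mathrm{enum}(F,\{x\},L)$ (with $G=\mathrm{idg}(F)$ for the current $F$): if $\overline x$ is reachable from $x$ in $G$, call DFS with empty path and vertex $x$. DFS$(P,y)$: append $y$ to $P$; if $V(P)$ contains a complementary pair call OUTPUT$(P)$; otherwise compute the set $R$ of out-neighbours $z$ of $y$ in $G-V(P)$ from which $\overline x$ is reachable in $G-V(P)$, and for each $z\in R$ in order $L$ call DFS$(P,z)$. OUTPUT$(P)$: if the last arc of $P$ is a unit, print $F(P)$; otherwise with $P=P_0;P_1$ and $P'=P_0;\overline{P_1}$, print $F(P)$ only if $P<_LP'$. *)

theory Defs
  imports
    "Graph_Theory.Pair_Digraph"
    "Graph_Theory.Digraph_Component"
    "Graph_Theory.Vertex_Walk"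
begin

datatype 'v lit = Pos (var: 'v) | Neg (var: 'v)

fun compl :: "'v lit \<Rightarrow> 'v lit" where
  "compl (Pos v) = Neg v"
| "compl (Neg v) = Pos v"

type_synonym 'v clause = "'v lit set"
type_synonym 'v clauses = "'v clause set"

definition is_clause :: "'v clause \<Rightarrow> bool" where
  "is_clause C \<longleftrightarrow> finite C \<and> (\<forall>a\<in>C. compl a \<notin> C)"

definition is_clause_set :: "'v clauses \<Rightarrow> bool" where
  "is_clause_set F \<longleftrightarrow> finite F \<and> (\<forall>C\<in>F. is_clause C)"

definition vars :: "'v clauses \<Rightarrow> 'v set" where
  "vars F = var ` \<Union>F"

(* Both literals over each occurring variable, whether or not they occur themselves. *)
definition lits :: "'v clauses \<Rightarrow> 'v lit set" where
  "lits F = {a. var a \<in> vars F}"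

fun lit_true :: "('v \<Rightarrow> bool) \<Rightarrow> 'v lit \<Rightarrow> bool" where
  "lit_true \<phi> (Pos v) \<longleftrightarrow> \<phi> v"
| "lit_true \<phi> (Neg v) \<longleftrightarrow> \<not> \<phi> v"

definition satisfiable :: "'v clauses \<Rightarrow> bool" where
  "satisfiable F \<longleftrightarrow> (\<exists>\<phi>. \<forall>C\<in>F. \<exists>a\<in>C. lit_true \<phi> a)"

definition minimally_unsat :: "'v clauses \<Rightarrow> bool" where
  "minimally_unsat F \<longleftrightarrow> \<not> satisfiable F \<and> (\<forall>C\<in>F. satisfiable (F - {C}))"

(* A binary clause {a, b} contributes two arcs, since a and b can be exchanged;
   the case a = b is that of the unit-clause {a}, contributing the arc (compl a, a). *)
definition idg :: "'v clauses \<Rightarrow> 'v lit pair_pre_digraph" where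
  "idg F = \<lparr> pverts = lits F, parcs = {(compl a, b) | a b. {a, b} \<in> F} \<rparr>"

definition is_unit_arc :: "'v lit \<times> 'v lit \<Rightarrow> bool" where
  "is_unit_arc e \<longleftrightarrow> snd e = compl (fst e)"

definition CL :: "('v lit \<times> 'v lit) set \<Rightarrow> 'v clauses" where
  "CL A = {{compl a, b} | a b. (a, b) \<in> A}"

(* Paths are given by their sequences of vertices, as in vpath;
   vwalk_arcs yields the corresponding sequence of arcs. *)

definition comp_pairs :: "'v lit list \<Rightarrow> 'v lit set set" where
  "comp_pairs P = {{a, compl a} | a. a \<in> set P \<and> compl a \<in> set P}"

definition regular :: "'v lit list \<Rightarrow> bool" where
  "regular P \<longleftrightarrow> comp_pairs P = {}"

definition nearly_regular :: "'v lit list \<Rightarrow> bool" where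
  "nearly_regular P \<longleftrightarrow> card (comp_pairs P) = 1 \<and> regular (butlast P)"

definition nr_paths :: "'v lit pair_pre_digraph \<Rightarrow> 'v lit \<Rightarrow> 'v lit list set" where
  "nr_paths G z = {P. vpath P (with_proj G) \<and> nearly_regular P \<and> hd P = z}"

definition path_clauses :: "'v lit list \<Rightarrow> 'v clauses" where
  "path_clauses P = CL (set (vwalk_arcs P)) \<union> {{hd P}}"

(* The regular decomposition P = P0;P1. The vertex compl (last P), at which P is split,
   is both the last vertex of P0 and the first vertex of P1. *)
definition reg_fst :: "'v lit list \<Rightarrow> 'v lit list" where
  "reg_fst P = takeWhile (\<lambda>a. a \<noteq> compl (last P)) P @ [compl (last P)]"

definition reg_snd :: "'v lit list \<Rightarrow> 'v lit list" where
  "reg_snd P = dropWhile (\<lambda>a. a \<noteq> compl (last P)) P"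

(* Replacing every arc (a, b) by (compl b, compl a), in reversed order, means
   complementing all vertices and reversing their sequence. *)
definition contraposition :: "'v lit list \<Rightarrow> 'v lit list" where
  "contraposition P = rev (map compl P)"

(* P;Q, where the last vertex of P is the first vertex of Q *)
definition path_join :: "'v lit list \<Rightarrow> 'v lit list \<Rightarrow> 'v lit list" where
  "path_join P Q = P @ tl Q"

definition lex_less :: "'v lit rel \<Rightarrow> 'v lit list \<Rightarrow> 'v lit list \<Rightarrow> bool" where
  "lex_less L P Q \<longleftrightarrow> (P, Q) \<in> lexord (L - Id)"

definition first_unit :: "'v lit rel \<Rightarrow> 'v clauses \<Rightarrow> 'v lit" where
  "first_unit L F' = (THE z. {z} \<in> F' \<and> (\<forall>z'. {z'} \<in> F' \<longrightarrow> (z, z') \<in> L))"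

definition first_path :: "'v lit pair_pre_digraph \<Rightarrow> 'v lit rel \<Rightarrow> 'v clauses \<Rightarrow> 'v lit list" where
  "first_path G L F' =
    (let \<P> = {P \<in> nr_paths G (first_unit L F'). path_clauses P = F'}
     in THE P. P \<in> \<P> \<and> (\<forall>Q\<in>\<P>. Q = P \<or> lex_less L P Q))"

definition pathlex_less ::
    "'v lit pair_pre_digraph \<Rightarrow> 'v lit rel \<Rightarrow> 'v clauses \<Rightarrow> 'v clauses \<Rightarrow> bool" where
  "pathlex_less G L F' F'' \<longleftrightarrow> lex_less L (first_path G L F') (first_path G L F'')"

(* The elements of the finite set A in the order given by L, which has to be linear on A *)
definition ordered_list :: "'a rel \<Rightarrow> 'a set \<Rightarrow> 'a list" where
  "ordered_list L A = (THE xs. distinct xs \<and> set xs = A \<and> sorted_wrt (\<lambda>a b. (a, b) \<in> L) xs)"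

lemma set_ordered_list:
  assumes "finite A" and "linear_order_on A (Restr L A)"
  shows "set (ordered_list L A) = A"
proof -
  let ?P = "\<lambda>xs. distinct xs \<and> set xs = A \<and> sorted_wrt (\<lambda>a b. (a, b) \<in> L) xs"
  have tot: "(a, b) \<in> L \<or> (b, a) \<in> L" if "a \<in> A" "b \<in> A" for a b
  proof (cases "a = b")
    case True
    then show ?thesis using assms(2) that by (simp add: order_on_defs refl_on_def)
  next
    case False
    then show ?thesis using assms(2) that by (simp add: order_on_defs total_on_def)
  qed
  have anti: "a = b" if "a \<in> A" "b \<in> A" "(a, b) \<in> L" "(b, a) \<in> L" for a b
    using assms(2) that antisymD[of "Restr L A" a b] by (simp add: order_on_defs)
  have tr: "(a, c) \<in> L" if "a \<in> A" "b \<in> A" "c \<in> A" "(a, b) \<in> L" "(b, c) \<in> L" for a b c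
    using assms(2) that transD[of "Restr L A" a b c] by (simp add: order_on_defs)
  have ex: "\<exists>xs. distinct xs \<and> set xs = B \<and> sorted_wrt (\<lambda>a b. (a, b) \<in> L) xs"
    if "finite B" "B \<subseteq> A" for B
    using that
  proof (induction rule: finite_induct)
    case empty
    then show ?case by simp
  next
    case (insert x B)
    then obtain xs where xs: "distinct xs" "set xs = B" "sorted_wrt (\<lambda>a b. (a, b) \<in> L) xs"
      by auto
    let ?l = "filter (\<lambda>a. (a, x) \<in> L) xs" and ?r = "filter (\<lambda>a. (a, x) \<notin> L) xs"
    have "sorted_wrt (\<lambda>a b. (a, b) \<in> L) (?l @ x # ?r)"
    proof -
      have l: "(a, x) \<in> L" if "a \<in> set ?l" for a using that by simp
      have r: "(x, b) \<in> L" if "b \<in> set ?r" for b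
        using that xs(2) insert.prems tot[of b x] by auto
      have lr: "(a, b) \<in> L" if "a \<in> set ?l" "b \<in> set ?r" for a b
      proof (rule tr[of a x b])
        show "a \<in> A" "b \<in> A" using that xs(2) insert.prems by auto
        show "x \<in> A" using insert.prems by simp
      qed (use l[OF that(1)] r[OF that(2)] in simp_all)
      show ?thesis
        unfolding sorted_wrt_append sorted_wrt.simps set_simps
        by (intro conjI ballI sorted_wrt_filter xs(3)) (erule r, erule insertE, simp only: l, rule lr)
    qed
    moreover have "distinct (?l @ x # ?r)" "set (?l @ x # ?r) = insert x B"
      using xs insert.hyps by auto
    ultimately show ?case by blast
  qed
  have uniq: "xs = ys"
    if "distinct xs" "distinct ys" "set xs = set ys" "set xs \<subseteq> A"
      "sorted_wrt (\<lambda>a b. (a, b) \<in> L) xs" "sorted_wrt (\<lambda>a b. (a, b) \<in> L) ys" for xs ys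
    using that
  proof (induction xs arbitrary: ys)
    case Nil
    then show ?case by simp
  next
    case (Cons x xs)
    then obtain y ys' where ys: "ys = y # ys'" by (cases ys) auto
    have "x = y"
    proof (rule ccontr)
      assume "x \<noteq> y"
      then have "x \<in> set ys'" "y \<in> set xs" using Cons.prems ys by auto
      then have "(x, y) \<in> L" "(y, x) \<in> L" using Cons.prems(5,6) ys by simp_all
      then show False using anti[of x y] \<open>x \<noteq> y\<close> \<open>y \<in> set xs\<close> Cons.prems(4) by auto
    qed
    moreover have "xs = ys'"
    proof (rule Cons.IH)
      show "set xs = set ys'"
        using Cons.prems(1-3) ys \<open>x = y\<close> by (simp add: insert_ident)
      show "set xs \<subseteq> A" using Cons.prems(4) by auto
    qed (use Cons.prems ys in simp_all)
    ultimately show ?case using ys by simp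
  qed
  from ex[OF assms(1)] obtain xs where "?P xs" by blast
  then have "?P (ordered_list L A)"
    unfolding ordered_list_def
  proof (rule theI)
    fix ys assume "?P ys"
    with \<open>?P xs\<close> show "ys = xs" by (intro uniq) simp_all
  qed
  then show ?thesis by blast
qed

definition emit :: "'v lit rel \<Rightarrow> 'v lit list \<Rightarrow> 'v clauses list" where
  "emit L P =
    (if is_unit_arc (last (vwalk_arcs P)) then [path_clauses P]
     else if lex_less L P (path_join (reg_fst P) (contraposition (reg_snd P))) then [path_clauses P]
     else [])"

(* The set R computed by DFS, with P already extended by y;
   the vertices of G - V(P) are those of G not in P. *)
definition dfs_successors ::
    "'v lit pair_pre_digraph \<Rightarrow> 'v lit \<Rightarrow> 'v lit list \<Rightarrow> 'v lit \<Rightarrow> 'v lit set" where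
  "dfs_successors G x P y =
    (let U = pverts G - set P
     in {z \<in> U. (y, z) \<in> parcs G \<and> z \<rightarrow>\<^sup>*\<^bsub>with_proj G \<restriction> U\<^esub> compl x})"

(* The locale assumptions serve for the termination of DFS. *)
locale ordered_literal_digraph = pair_fin_digraph G
  for G :: "'v lit pair_pre_digraph" +
  fixes L :: "'v lit rel"
  assumes linear: "linear_order_on (pverts G) (Restr L (pverts G))"
begin

lemma set_ordered_list_verts:
  assumes "A \<subseteq> pverts G"
  shows "set (ordered_list L A) = A"
proof (rule set_ordered_list)
  show "finite A" using assms pair_finite_verts finite_subset by blast
  show "linear_order_on A (Restr L A)"
    using linear assms
    by (simp add: order_on_defs refl_on_def total_on_def antisym_def trans_def subset_iff) blast
qed

function dfs :: "'v lit \<Rightarrow> 'v lit list \<Rightarrow> 'v lit \<Rightarrow> 'v clauses list" where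
  "dfs x P y =
    (if \<not> regular (P @ [y]) then emit L (P @ [y])
     else concat (map (\<lambda>z. dfs x (P @ [y]) z)
       (ordered_list L (dfs_successors G x (P @ [y]) y))))"
  by pat_completeness auto
termination
proof (relation "measure (\<lambda>(x, P, y). card (pverts G - set (P @ [y])))")
  fix x P y z
  assume "z \<in> set (ordered_list L (dfs_successors G x (P @ [y]) y))"
  moreover have "dfs_successors G x (P @ [y]) y \<subseteq> pverts G"
    by (auto simp: dfs_successors_def Let_def)
  ultimately have "z \<in> pverts G - set (P @ [y])"
    using set_ordered_list_verts by (auto simp: dfs_successors_def Let_def)
  then have "pverts G - set ((P @ [y]) @ [z]) \<subset> pverts G - set (P @ [y])" by auto
  then have "card (pverts G - set ((P @ [y]) @ [z])) < card (pverts G - set (P @ [y]))"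
    using pair_finite_verts by (intro psubset_card_mono) auto
  then show "((x, P @ [y], z), (x, P, y)) \<in> measure (\<lambda>(x, P, y). card (pverts G - set (P @ [y])))"
    by (simp add: insert_commute)
qed simp

declare dfs.simps [simp del]

end

definition enum_unit :: "'v lit rel \<Rightarrow> 'v clauses \<Rightarrow> 'v lit \<Rightarrow> 'v clauses list" where
  "enum_unit L F x =
    (if x \<rightarrow>\<^sup>*\<^bsub>with_proj (idg F)\<^esub> compl x then ordered_literal_digraph.dfs (idg F) L x [] x else [])"

fun enum_loop :: "'v lit rel \<Rightarrow> 'v clauses \<Rightarrow> 'v lit list \<Rightarrow> 'v clauses list" where
  "enum_loop L F [] = []"
| "enum_loop L F (x # xs) = enum_unit L F x @ enum_loop L (F - {{x}}) xs"

definition enum_all :: "'v lit rel \<Rightarrow> 'v clauses \<Rightarrow> 'v clauses list" where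
  "enum_all L F = enum_loop L F (ordered_list L {x. {x} \<in> F})"

(* The equations for DFS are available for every digraph arising in the procedure. *)
lemma ordered_literal_digraph_idg:
  assumes "is_clause_set F" and "linear_order_on (lits F) L" and "F' \<subseteq> F"
  shows "ordered_literal_digraph (idg F') L"
proof -
  have sub: "lits F' \<subseteq> lits F" using assms(3) by (auto simp: lits_def vars_def)
  have "lits F' \<subseteq> Pos ` vars F' \<union> Neg ` vars F'"
  proof
    fix a assume "a \<in> lits F'"
    then show "a \<in> Pos ` vars F' \<union> Neg ` vars F'" by (cases a) (auto simp: lits_def)
  qed
  moreover have "finite (vars F')"
    using assms(1,3) finite_subset[of F' F]
    by (auto simp: is_clause_set_def is_clause_def vars_def)
  ultimately have fin: "finite (lits F')" using finite_subset by blast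
  have var_compl: "var (compl a) = var a" for a :: "'a lit" by (cases a) auto
  have arcs: "parcs (idg F') \<subseteq> lits F' \<times> lits F'"
    by (auto simp: idg_def lits_def vars_def var_compl)
  have in_lits: "fst e \<in> lits F'" "snd e \<in> lits F'" if "e \<in> parcs (idg F')" for e
    using subsetD[OF arcs that] by (simp_all add: mem_Times_iff)
  have "linear_order_on (lits F') (Restr L (lits F'))"
    using assms(2) sub
    by (simp add: order_on_defs refl_on_def total_on_def antisym_def trans_def subset_iff) blast
  moreover have "pverts (idg F') = lits F'" by (simp add: idg_def)
  moreover have "finite (parcs (idg F'))" using finite_subset[OF arcs] fin by blast
  ultimately show ?thesis
    using fin by unfold_locales (simp_all add: in_lits)
qed

end

theory Submission
  imports Defs "HOL-Library.Sublist"
begin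

text \<open>
  A nearly regular path from \<open>z\<close>, together with the unit-clause \<open>{z}\<close>, forces all its vertices to be
  true and hence a contradiction, and cutting the path anywhere leaves a consistent assignment; so its
  clauses are minimally unsatisfiable. Conversely, unsatisfiability makes some complementary pair,
  hence by skew-symmetry of the implication digraph also \<open>compl z\<close>, reachable from \<open>z\<close>, and the
  shortest non-regular prefix of a path from \<open>z\<close> to \<open>compl z\<close> already exhausts a minimally
  unsatisfiable clause-set. Another nearly regular path from \<open>z\<close> with the same clauses can leave
  \<open>P = P\<^sub>0;P\<^sub>1\<close> only at the splitting vertex, into the contraposition of \<open>P\<^sub>1\<close>. The reachability
  test of DFS prunes no nearly regular path, since \<open>P\<close> continues by the contraposition of \<open>P\<^sub>0\<close>
  to \<open>compl z\<close>; so DFS runs through all of them in lexicographic order.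
\<close>

section \<open>Literals, arc sequences and the implication digraph\<close>

lemma compl_compl [simp]: "compl (compl a) = a"
  by (cases a) auto

lemma compl_neq [simp]: "compl a \<noteq> a" "a \<noteq> compl a"
  by (cases a; simp)+

lemma compl_inject [simp]: "compl a = compl b \<longleftrightarrow> a = b"
  by (cases a; cases b) auto

lemma compl_in_image_iff [simp]: "compl a \<in> compl ` S \<longleftrightarrow> a \<in> S"
  by auto

lemma in_compl_image_iff: "a \<in> compl ` S \<longleftrightarrow> compl a \<in> S"
  by (metis compl_compl compl_in_image_iff)

lemma var_compl [simp]: "var (compl a) = var a"
  by (cases a) auto

lemma lit_true_compl [simp]: "lit_true \<phi> (compl a) \<longleftrightarrow> \<not> lit_true \<phi> a"
  by (cases a) auto

text \<open>\<open>S\<close> acts as a partial assignment: a variable is made true exactly when its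
  positive literal lies in \<open>S\<close>, and consistency then makes the negative literals of
  \<open>S\<close> true as well.\<close>

lemma satisfiableI_consistent:
  assumes "\<And>a. a \<in> S \<Longrightarrow> compl a \<notin> S" and "\<And>C. C \<in> F \<Longrightarrow> \<exists>a\<in>C. a \<in> S"
  shows "satisfiable F"
proof -
  have "lit_true (\<lambda>v. Pos v \<in> S) a" if "a \<in> S" for a
    using that assms(1)[OF that] by (cases a) auto
  then show ?thesis unfolding satisfiable_def using assms(2) by blast
qed

lemma in_vwalk_arcs_iff: "(a, b) \<in> set (vwalk_arcs P) \<longleftrightarrow> (\<exists>U V. P = U @ a # b # V)"
proof (induction P rule: vwalk_arcs.induct)
  case (3 x y xs)
  then show ?case
    by (auto simp: Cons_eq_append_conv)
qed auto

lemma vwalk_arcs_map: "vwalk_arcs (map f P) = map (map_prod f f) (vwalk_arcs P)"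
  by (induction P rule: vwalk_arcs.induct) auto

lemma in_vwalk_arcsD:
  assumes "(a, b) \<in> set (vwalk_arcs P)"
  shows "a \<in> set (butlast P)" "b \<in> set (tl P)" "a \<in> set P" "b \<in> set P"
proof -
  from assms obtain U V where P: "P = U @ a # b # V"
    by (auto simp: in_vwalk_arcs_iff)
  then show "a \<in> set (butlast P)" "b \<in> set (tl P)" "a \<in> set P" "b \<in> set P"
    by (cases U; auto simp: butlast_append)+
qed

lemma in_CL_iff: "C \<in> CL A \<longleftrightarrow> (\<exists>a b. (a, b) \<in> A \<and> C = {compl a, b})"
  by (auto simp: CL_def)

lemma CL_Un: "CL (A \<union> B) = CL A \<union> CL B"
  by (auto simp: CL_def)

lemma pverts_idg [simp]: "pverts (idg F) = lits F"
  by (simp add: idg_def)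

lemma in_parcs_idg_iff: "(a, b) \<in> parcs (idg F) \<longleftrightarrow> {compl a, b} \<in> F"
  by (auto simp: idg_def) (metis compl_compl)

lemma CL_subset_iff: "CL A \<subseteq> F \<longleftrightarrow> A \<subseteq> parcs (idg F)"
  by (auto simp: in_parcs_idg_iff in_CL_iff subset_iff)

lemma idg_skew_symmetric: "(a, b) \<in> parcs (idg F) \<Longrightarrow> (compl b, compl a) \<in> parcs (idg F)"
  by (simp add: in_parcs_idg_iff insert_commute)

lemma pair_wf_digraph_idg: "pair_wf_digraph (idg F)"
proof
  fix e assume "e \<in> parcs (idg F)"
  then have "{compl (fst e), snd e} \<in> F"
    by (metis in_parcs_idg_iff prod.collapse)
  then have "var (compl (fst e)) \<in> vars F" "var (snd e) \<in> vars F"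
    unfolding vars_def by blast+
  then show "fst e \<in> pverts (idg F)" "snd e \<in> pverts (idg F)"
    by (simp_all add: lits_def)
qed

section \<open>Regular and nearly regular paths\<close>

lemma regular_iff: "regular P \<longleftrightarrow> (\<forall>a\<in>set P. compl a \<notin> set P)"
  by (auto simp: regular_def comp_pairs_def)

text \<open>If \<open>butlast P\<close> is regular, every complementary pair of \<open>P\<close>
  contains the last vertex, so there is at most one.\<close>

lemma nearly_regular_iff: "nearly_regular P \<longleftrightarrow> regular (butlast P) \<and> \<not> regular P"
proof
  assume "nearly_regular P"
  then show "regular (butlast P) \<and> \<not> regular P"
    by (auto simp: nearly_regular_def regular_def)
next
  assume *: "regular (butlast P) \<and> \<not> regular P"
  then have "P \<noteq> []" by auto
  then obtain Q w where P: "P = Q @ [w]" by (metis append_butlast_last_id)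
  with * have "comp_pairs P = {{w, compl w}}"
    by (auto simp: regular_iff comp_pairs_def)
  with * show "nearly_regular P" by (simp add: nearly_regular_def)
qed

text \<open>The normal form behind most later arguments: \<open>v\<close> is the splitting vertex,
  so for distinct \<open>P\<close> the regular decomposition consists of \<open>A @ [v]\<close> and
  \<open>v # B @ [compl v]\<close>.\<close>

lemma nearly_regularE:
  assumes "nearly_regular P"
  obtains A v B where "P = A @ v # B @ [compl v]" "regular (A @ v # B)"
proof -
  from assms have "P \<noteq> []" by (auto simp: nearly_regular_iff)
  then obtain Q w where P: "P = Q @ [w]" by (metis append_butlast_last_id)
  with assms have "compl w \<in> set Q"
    by (auto simp: nearly_regular_iff regular_iff)
  then obtain A B where "Q = A @ compl w # B" by (meson split_list)
  then show thesis using that[of A "compl w" B] P assms by (simp add: nearly_regular_iff butlast_append)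
qed

lemma nearly_regularI: "regular (A @ v # B) \<Longrightarrow> nearly_regular (A @ v # B @ [compl v])"
  by (auto simp: nearly_regular_iff butlast_append regular_iff)

text \<open>A proper prefix of \<open>Q\<close> is a prefix of the regular list
  \<open>butlast Q\<close>.\<close>

lemma nearly_regular_prefix_eq:
  assumes "nearly_regular P" "nearly_regular Q" "prefix P Q"
  shows "P = Q"
proof (rule ccontr)
  assume "P \<noteq> Q"
  with assms(3) obtain z zs where "Q = P @ z # zs"
    by (meson strict_prefixI strict_prefixE')
  then have "regular P"
    using assms(2) by (auto simp: nearly_regular_iff butlast_append regular_iff)
  with assms(1) show False by (simp add: nearly_regular_iff)
qed

text \<open>Neither path is a prefix of the other, so they part somewhere; the common start
  guarantees a last common vertex \<open>c\<close>.\<close>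

lemma nearly_regular_divergeE:
  assumes "nearly_regular P" "nearly_regular Q" "hd P = hd Q" "P \<noteq> Q"
  obtains U c a b V W where "P = U @ c # a # V" "Q = U @ c # b # W" "a \<noteq> b"
proof -
  have "\<not> prefix P Q" "\<not> prefix Q P"
    using nearly_regular_prefix_eq assms by metis+
  then have "P \<parallel> Q" by blast
  then obtain U a b V W where *: "a \<noteq> b" "P = U @ a # V" "Q = U @ b # W"
    using parallel_decomp by blast
  with assms(3) have "U \<noteq> []" by auto
  then obtain U' c where "U = U' @ [c]" by (metis append_butlast_last_id)
  with * that show thesis by auto
qed

lemma ex_nearly_regular_prefix: "\<not> regular P \<Longrightarrow> \<exists>Q. prefix Q P \<and> nearly_regular Q"
proof (induction P rule: rev_induct)
  case Nil
  then show ?case by (simp add: regular_iff)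
next
  case (snoc w P)
  show ?case
  proof (cases "regular P")
    case True
    then have "nearly_regular (P @ [w])" using snoc.prems by (simp add: nearly_regular_iff)
    then show ?thesis by blast
  next
    case False
    then show ?thesis using snoc.IH by auto
  qed
qed

text \<open>Turns the conditions on the digraph into an inclusion of clauses: \<open>z\<close> is a
  vertex because of its unit-clause, and every later vertex is the head of an arc.\<close>

lemma nr_paths_idg_iff:
  assumes "{z} \<in> F"
  shows "P \<in> nr_paths (idg F) z \<longleftrightarrow>
    nearly_regular P \<and> distinct P \<and> hd P = z \<and> path_clauses P \<subseteq> F"
proof -
  have "set P \<subseteq> lits F"
    if "P \<noteq> []" "hd P = z" and arcs: "set (vwalk_arcs P) \<subseteq> parcs (idg F)"
  proof
    fix c assume "c \<in> set P"
    then obtain U V where P: "P = U @ c # V" by (meson split_list)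
    show "c \<in> lits F"
    proof (cases U rule: rev_cases)
      case Nil
      with P that(2) assms show ?thesis by (auto simp: lits_def vars_def)
    next
      case (snoc U' d)
      with P have "(d, c) \<in> set (vwalk_arcs P)" by (auto simp: in_vwalk_arcs_iff)
      then show ?thesis using arcs pair_wf_digraph.in_arcsD2[OF pair_wf_digraph_idg] by force
    qed
  qed
  moreover have "P \<noteq> []" if "nearly_regular P"
    using that by (auto simp: nearly_regular_iff)
  ultimately show ?thesis
    using assms by (auto simp: nr_paths_def vpath_def vwalk_def path_clauses_def CL_subset_iff)
qed

section \<open>Minimal unsatisfiability of the clauses of a nearly regular path\<close>

lemma lit_true_propagates:
  assumes "\<And>a b. (a, b) \<in> set (vwalk_arcs P) \<Longrightarrow> lit_true \<phi> a \<Longrightarrow> lit_true \<phi> b"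
    and "lit_true \<phi> (hd P)" "c \<in> set P"
  shows "lit_true \<phi> c"
  using assms by (induction P rule: vwalk_arcs.induct) auto

lemma unsatisfiable_path_clauses:
  assumes "nearly_regular P"
  shows "\<not> satisfiable (path_clauses P)"
proof
  assume "satisfiable (path_clauses P)"
  then obtain \<phi> where \<phi>: "\<And>C. C \<in> path_clauses P \<Longrightarrow> \<exists>a\<in>C. lit_true \<phi> a"
    by (auto simp: satisfiable_def)
  have "lit_true \<phi> c" if "c \<in> set P" for c
  proof (rule lit_true_propagates[OF _ _ that])
    show "lit_true \<phi> (hd P)" using \<phi>[of "{hd P}"] by (simp add: path_clauses_def)
    fix a b assume "(a, b) \<in> set (vwalk_arcs P)" "lit_true \<phi> a"
    then show "lit_true \<phi> b"
      using \<phi>[of "{compl a, b}"] by (auto simp: path_clauses_def in_CL_iff)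
  qed
  moreover obtain a where "a \<in> set P" "compl a \<in> set P"
    using assms by (auto simp: nearly_regular_iff regular_iff)
  ultimately show False by (metis lit_true_compl)
qed

text \<open>Without the unit-clause of the start, all of \<open>butlast P\<close> can be made false.
  Without the clause of an arc \<open>(a, b)\<close>, the vertices up to \<open>a\<close> are made
  true and those from \<open>b\<close> on, except the last, false.\<close>

theorem minimally_unsat_path_clauses:
  assumes nr: "nearly_regular P" and "distinct P"
  shows "minimally_unsat (path_clauses P)"
  unfolding minimally_unsat_def
proof (intro conjI ballI)
  show "\<not> satisfiable (path_clauses P)" using nr by (rule unsatisfiable_path_clauses)
  fix C assume C: "C \<in> path_clauses P"
  show "satisfiable (path_clauses P - {C})"
  proof (cases "C = {hd P}")
    case True
    show ?thesis
    proof (rule satisfiableI_consistent[where S = "compl ` set (butlast P)"])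
      fix a assume "a \<in> compl ` set (butlast P)"
      then show "compl a \<notin> compl ` set (butlast P)"
        using nr by (auto simp: nearly_regular_iff regular_iff in_compl_image_iff)
    next
      fix D assume "D \<in> path_clauses P - {C}"
      then show "\<exists>a\<in>D. a \<in> compl ` set (butlast P)"
        using True by (auto simp: path_clauses_def in_CL_iff dest: in_vwalk_arcsD)
    qed
  next
    case False
    with C obtain a b where "(a, b) \<in> set (vwalk_arcs P)" and Cab: "C = {compl a, b}"
      by (auto simp: path_clauses_def in_CL_iff)
    then obtain U V where P: "P = (U @ [a]) @ b # V" by (auto simp: in_vwalk_arcs_iff)
    then have bl: "butlast P = (U @ [a]) @ butlast (b # V)" by (auto simp: butlast_append)
    let ?S = "set (U @ [a]) \<union> compl ` set (butlast (b # V))"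
    have reg: "regular ((U @ [a]) @ butlast (b # V))"
      using nr bl by (simp add: nearly_regular_iff)
    \<comment> \<open>Distinctness excludes a vertex that is to be true before the cut and false
      behind it; regularity excludes the other conflicts.\<close>
    have dis: "distinct ((U @ [a]) @ butlast (b # V))"
      using \<open>distinct P\<close> bl by (metis distinct_butlast)
    show ?thesis
    proof (rule satisfiableI_consistent[where S = ?S])
      fix c assume "c \<in> ?S"
      then show "compl c \<notin> ?S"
        using reg dis unfolding regular_iff distinct_append set_append in_compl_image_iff
        by (auto simp del: set_append butlast.simps simp: in_compl_image_iff)
    next
      fix D assume D: "D \<in> path_clauses P - {C}"
      then consider "D = {hd P}"
        | c d where "(c, d) \<in> set (vwalk_arcs P)" "D = {compl c, d}" "(c, d) \<noteq> (a, b)"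
        using Cab by (auto simp: path_clauses_def in_CL_iff)
      then show "\<exists>c\<in>D. c \<in> ?S"
      proof cases
        case 1
        then show ?thesis using P by (cases U) auto
      next
        case 2
        \<comment> \<open>An arc other than \<open>(a, b)\<close> lies on one side of the cut, so
          its head is true or its tail false.\<close>
        then have "(c, d) \<in> set (vwalk_arcs (U @ [a])) \<or> (c, d) \<in> set (vwalk_arcs (b # V))"
          using P vwalk_arcs_append[of "U @ [a]" "b # V"] by auto
        then have "d \<in> set (U @ [a]) \<or> c \<in> set (butlast (b # V))"
          using in_vwalk_arcsD by metis
        then show ?thesis using 2 by blast
      qed
    qed
  qed
qed

section \<open>Contraposing the second part of the regular decomposition\<close>

text \<open>The path \<open>P'\<close> of OUTPUT: the only possible second path with the start and
  the clauses of \<open>P\<close>.\<close>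

abbreviation flip :: "'v lit list \<Rightarrow> 'v lit list" where
  "flip P \<equiv> path_join (reg_fst P) (contraposition (reg_snd P))"

lemma flip_eq:
  assumes "v \<notin> set A"
  shows "flip (A @ v # B @ [compl v]) = A @ v # rev (map compl B) @ [compl v]"
proof -
  have "takeWhile (\<lambda>a. a \<noteq> v) (A @ v # B @ [compl v]) = A \<and>
    dropWhile (\<lambda>a. a \<noteq> v) (A @ v # B @ [compl v]) = v # B @ [compl v]"
    using assms by (induction A) auto
  then show ?thesis
    by (simp add: path_join_def reg_fst_def reg_snd_def contraposition_def)
qed

lemma set_vwalk_arcs_contraposition:
  "set (vwalk_arcs (contraposition P)) = (\<lambda>(a, b). (compl b, compl a)) ` set (vwalk_arcs P)"
  by (force simp: contraposition_def set_vwalk_arcs_rev vwalk_arcs_map)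

text \<open>An arc and its contrapositive yield the same clause, as clauses are unordered.\<close>

lemma CL_contraposition: "CL (set (vwalk_arcs (contraposition P))) = CL (set (vwalk_arcs P))"
proof -
  have "C \<in> CL (set (vwalk_arcs (contraposition P))) \<longleftrightarrow>
    (\<exists>a b. (a, b) \<in> set (vwalk_arcs P) \<and> C = {b, compl a})" for C
    by (force simp: in_CL_iff set_vwalk_arcs_contraposition)
  then show ?thesis by (auto simp: in_CL_iff insert_commute)
qed

lemma path_clauses_split:
  "path_clauses (A @ v # B) =
    CL (set (vwalk_arcs (A @ [v]))) \<union> CL (set (vwalk_arcs (v # B))) \<union> {{hd (A @ [v])}}"
proof -
  have "vwalk_arcs (A @ v # B) = vwalk_arcs (A @ [v]) @ vwalk_arcs (v # B)"
    using vwalk_join_arcs[of "A @ [v]" "v # B"] by (simp add: vwalk_join_def)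
  moreover have "hd (A @ v # B) = hd (A @ [v])" by (cases A) simp_all
  ultimately show ?thesis by (simp only: path_clauses_def set_append CL_Un)
qed

lemma nearly_regular_pathE:
  assumes "nearly_regular P" "distinct P"
  obtains A v B where "P = A @ v # B @ [compl v]" "regular (A @ v # B)"
    "distinct (A @ v # B @ [compl v])" "flip P = A @ v # rev (map compl B) @ [compl v]"
    "is_unit_arc (last (vwalk_arcs P)) \<longleftrightarrow> B = []"
proof -
  obtain A v B where P: "P = A @ v # B @ [compl v]" and reg: "regular (A @ v # B)"
    using assms(1) by (rule nearly_regularE)
  then have d: "distinct (A @ v # B @ [compl v])" using assms(2) by simp
  then have flip: "flip P = A @ v # rev (map compl B) @ [compl v]"
    using flip_eq[of v A B] P by simp
  \<comment> \<open>The last arc ends in \<open>compl v\<close>, so it is a unit exactly if it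
    starts in \<open>v\<close>; by distinctness this means that \<open>B\<close> is empty.\<close>
  have "vwalk_arcs P = vwalk_arcs (A @ v # B) @ [(last (v # B), compl v)]"
    using vwalk_arcs_append[of "A @ v # B" "[compl v]"] P by simp
  then have "is_unit_arc (last (vwalk_arcs P)) \<longleftrightarrow> last (v # B) = v"
    by (auto simp: is_unit_arc_def)
  also have "\<dots> \<longleftrightarrow> B = []"
    using d last_in_set[of B] by auto
  finally show thesis using that P reg d flip by blast
qed

text \<open>Between \<open>A\<close> and the complemented \<open>B\<close>, distinctness and
  regularity exchange their roles: a common vertex of \<open>A\<close> and \<open>B\<close> would
  become a complementary pair, and conversely. Contraposition fixes the ends \<open>v\<close> and
  \<open>compl v\<close> of the second part.\<close>

lemma nearly_regular_flip:
  assumes "nearly_regular P" "distinct P"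
  shows "nearly_regular (flip P)" "distinct (flip P)" "hd (flip P) = hd P"
    "path_clauses (flip P) = path_clauses P" "flip (flip P) = P"
proof -
  obtain A v B where P: "P = A @ v # B @ [compl v]" and reg: "regular (A @ v # B)"
    and d: "distinct (A @ v # B @ [compl v])"
    and flip: "flip P = A @ v # rev (map compl B) @ [compl v]"
    using assms by (rule nearly_regular_pathE)
  have "regular (A @ v # rev (map compl B))"
    using reg d by (auto simp: regular_iff in_compl_image_iff)
  then show "nearly_regular (flip P)" unfolding flip
    using nearly_regularI[of A v "rev (map compl B)"] by simp
  show "distinct (flip P)"
    using reg d unfolding flip
    by (auto simp: distinct_map inj_on_def regular_iff in_compl_image_iff)
  show "hd (flip P) = hd P" using P flip by (cases A) simp_all
  have "contraposition (v # B @ [compl v]) = v # rev (map compl B) @ [compl v]"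
    by (simp add: contraposition_def)
  then show "path_clauses (flip P) = path_clauses P"
    using CL_contraposition[of "v # B @ [compl v]"] unfolding flip
    by (simp add: P path_clauses_split)
  show "flip (flip P) = P"
    unfolding flip using flip_eq[of v A "rev (map compl B)"] d P by (simp add: rev_map o_def)
qed

section \<open>Nearly regular paths with equal clauses\<close>

text \<open>The clause of the arc \<open>(c, a)\<close> by which \<open>Q\<close> leaves
  \<open>P\<close> must come from \<open>P\<close>. It is not the unit-clause of the start, and by
  distinctness \<open>(c, a)\<close> is no arc of \<open>P\<close>; so \<open>P\<close> contains the
  contrapositive \<open>(compl a, compl c)\<close>.\<close>

lemma path_divergence:
  assumes nr: "nearly_regular P" and d: "distinct P"
    and P: "P = U @ c # b # V" and Q: "Q = U @ c # a # W" and ne: "b \<noteq> a"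
    and sub: "path_clauses Q \<subseteq> path_clauses P"
  shows "c = compl (last P)" "a = compl (last (butlast P))"
proof -
  have "(c, a) \<in> set (vwalk_arcs Q)" using Q by (auto simp: in_vwalk_arcs_iff)
  then have "{compl c, a} \<in> path_clauses Q"
    by (auto simp: path_clauses_def in_CL_iff)
  then have "{compl c, a} \<in> path_clauses P" using sub by blast
  then consider "{compl c, a} = {hd P}"
    | d e where "(d, e) \<in> set (vwalk_arcs P)" "{compl c, a} = {compl d, e}"
    unfolding path_clauses_def Un_iff in_CL_iff by blast
  then have "c = compl (last P) \<and> a = compl (last (butlast P))"
  proof cases
    case 1
    then have "compl c = hd P" by blast
    moreover have "c \<in> set (butlast P)" "hd P \<in> set (butlast P)"
      using P by (cases U; simp add: butlast_append)+
    ultimately show ?thesis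
      using nr by (auto simp: nearly_regular_iff regular_iff)
  next
    case 2
    from 2(1) obtain U' V' where P': "P = U' @ d # e # V'"
      by (auto simp: in_vwalk_arcs_iff)
    from 2(2) consider "c = d" "a = e" | "compl c = e" "a = compl d"
      by (auto simp: doubleton_eq_iff)
    then show ?thesis
    proof cases
      case 1
      with P P' d have "b = a"
        by (auto simp: append_eq_append_conv2 append_eq_Cons_conv Cons_eq_append_conv)
      with ne show ?thesis by simp
    next
      case 2
      \<comment> \<open>As the complement of a vertex of the regular list \<open>butlast P\<close>,
        \<open>e\<close> can only be the last vertex of \<open>P\<close>.\<close>
      have "c \<in> set (butlast P)" using P by (simp add: butlast_append)
      then have "compl c \<notin> set (butlast P)" using nr by (auto simp: nearly_regular_iff regular_iff)
      with 2 P' have "V' = []" by (auto simp: butlast_append split: if_splits)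
      with 2 P' show ?thesis by (auto simp: butlast_append)
    qed
  qed
  then show "c = compl (last P)" "a = compl (last (butlast P))" by blast+
qed

lemma append_Cons_eq_unique:
  assumes "U @ c # V = U' @ c # V'" "distinct (U @ c # V)"
  shows "U = U' \<and> V = V'"
  using assms by (metis append_Cons_eq_iff distinct_append distinct.simps(2) not_distinct_conv_prefix)

text \<open>A third path \<open>Q\<close> would leave both \<open>P\<close> and
  \<open>flip P\<close> at \<open>v\<close>. Its next vertex would then be
  \<open>compl (last (butlast P))\<close>, but that is where \<open>flip P\<close> goes from
  \<open>v\<close>.\<close>

theorem path_clauses_eqD:
  assumes nrP: "nearly_regular P" and dP: "distinct P"
    and nrQ: "nearly_regular Q" and dQ: "distinct Q"
    and hd: "hd Q = hd P" and eq: "path_clauses Q = path_clauses P"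
  shows "Q = P \<or> Q = flip P"
proof (rule ccontr)
  assume neg: "\<not> (Q = P \<or> Q = flip P)"
  obtain A v B where P: "P = A @ v # B @ [compl v]"
    and d: "distinct (A @ v # B @ [compl v])"
    and fP: "flip P = A @ v # rev (map compl B) @ [compl v]"
    using nrP dP by (rule nearly_regular_pathE)
  note flip = nearly_regular_flip[OF nrP dP]
  obtain U c b a V W where 1: "P = U @ c # b # V" "Q = U @ c # a # W" "b \<noteq> a"
    using nearly_regular_divergeE[OF nrP nrQ] hd neg by metis
  obtain U' c' b' a' V' W' where 2: "flip P = U' @ c' # b' # V'" "Q = U' @ c' # a' # W'" "b' \<noteq> a'"
    using nearly_regular_divergeE[OF flip(1) nrQ] hd flip(3) neg by metis
  have c: "c = v" "a = compl (last (butlast P))"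
    using path_divergence[OF nrP dP 1] eq P by simp_all
  have c': "c' = v"
    using path_divergence(1)[OF flip(1,2) 2] flip(4) eq fP by simp
  \<comment> \<open>Both are the vertex after \<open>v\<close> on the distinct list
    \<open>Q\<close>.\<close>
  have "a = a'" using append_Cons_eq_unique[of U v "a # W" U' "a' # W'"] 1(2) 2(2) c(1) c' dQ
    by (metis list.inject)
  have b: "b # V = B @ [compl v]"
    using append_Cons_eq_unique[of A v "B @ [compl v]" U "b # V"] 1 c d P by simp
  have b': "b' # V' = rev (map compl B) @ [compl v]"
    using append_Cons_eq_unique[of A v "rev (map compl B) @ [compl v]" U' "b' # V'"]
      2(1) c' flip(2) fP by simp
  show False
  proof (cases B rule: rev_cases)
    case Nil
    then show False using b b' c(2) P 1(3) by (simp add: butlast_append)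
  next
    case (snoc B' l)
    then show False using b' c(2) P 2(3) \<open>a = a'\<close> by (simp add: butlast_append)
  qed
qed

section \<open>From minimally unsatisfiable clause-sets to paths\<close>

lemma idg_reachable_contraposition:
  assumes "a \<rightarrow>\<^sup>*\<^bsub>with_proj (idg F)\<^esub> b"
  shows "compl b \<rightarrow>\<^sup>*\<^bsub>with_proj (idg F)\<^esub> compl a"
proof -
  interpret pair_wf_digraph "idg F" by (rule pair_wf_digraph_idg)
  show ?thesis
    using assms
  proof (induction rule: reachable_induct)
    case base
    then show ?case by (simp add: lits_def)
  next
    case (step b c)
    then have "(compl c, compl b) \<in> parcs (idg F)"
      by (simp add: idg_skew_symmetric)
    from adj_reachable_trans[OF this step.IH] show ?case .
  qed
qed

lemma (in pair_wf_digraph) reachable_imp_vwalk: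
  assumes "u \<rightarrow>\<^sup>*\<^bsub>with_proj G\<^esub> v"
  shows "\<exists>p. vwalk p (with_proj G) \<and> hd p = u \<and> last p = v"
  using assms
proof (induction rule: reachable_induct)
  case base
  then show ?case by (intro exI[of _ "[u]"]) (auto simp: vwalk_def)
next
  case (step x y)
  then obtain p where "vwalk p (with_proj G)" "hd p = u" "last p = x" by blast
  with step(2) show ?case
    using in_arcsD2[of x y]
    by (intro exI[of _ "p @ [y]"]) (auto simp: vwalk_def set_vwalk_arcs_snoc)
qed

lemma (in wf_digraph) vwalk_imp_reachable:
  assumes "vwalk p G"
  shows "hd p \<rightarrow>\<^sup>* last p"
  using assms by (induction rule: vwalk_induct) (auto intro: adj_reachable_trans)

text \<open>Were the literals reachable from \<open>x\<close> consistent, setting them true in a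
  model of \<open>F - {{x}}\<close> would satisfy \<open>F\<close>. So there is a non-regular path
  from \<open>x\<close>; a nearly regular prefix of it has unsatisfiable clauses, and by minimality
  these are all of \<open>F\<close>.\<close>

theorem minimally_unsat_imp_path:
  assumes mu: "minimally_unsat F" and card: "\<forall>C\<in>F. card C = 1 \<or> card C = 2" and x: "{x} \<in> F"
  obtains P where "nearly_regular P" "distinct P" "hd P = x" "path_clauses P = F"
proof -
  interpret pair_wf_digraph "idg F" by (rule pair_wf_digraph_idg)
  define R where "R = {a. x \<rightarrow>\<^sup>*\<^bsub>with_proj (idg F)\<^esub> a}"
  have "x \<in> lits F" using x by (auto simp: lits_def vars_def)
  then have "x \<in> R" by (simp add: R_def)
  have closed: "b \<in> R" if "a \<in> R" "{compl a, b} \<in> F" for a b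
    using that reachable_adj_trans[of x a b] by (simp add: R_def in_parcs_idg_iff)
  have "\<exists>a\<in>R. compl a \<in> R"
  proof (rule ccontr)
    assume "\<not> ?thesis"
    then have consistent: "\<And>a. a \<in> R \<Longrightarrow> compl a \<notin> R" by blast
    have "satisfiable (F - {{x}})" using mu x by (simp add: minimally_unsat_def)
    then obtain \<phi> where \<phi>: "\<And>C. C \<in> F - {{x}} \<Longrightarrow> \<exists>a\<in>C. lit_true \<phi> a"
      unfolding satisfiable_def by blast
    let ?S = "R \<union> {a. lit_true \<phi> a \<and> a \<notin> R \<and> compl a \<notin> R}"
    have "satisfiable F"
    proof (rule satisfiableI_consistent[where S = ?S])
      fix a assume "a \<in> ?S"
      then show "compl a \<notin> ?S" using consistent by auto
    next
      fix C assume "C \<in> F"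
      show "\<exists>a\<in>C. a \<in> ?S"
      proof (cases "C = {x}")
        case True
        then show ?thesis using \<open>x \<in> R\<close> by blast
      next
        case False
        then obtain a where a: "a \<in> C" "lit_true \<phi> a" using \<phi> \<open>C \<in> F\<close> by blast
        \<comment> \<open>A unit-clause is the case \<open>a = b\<close>. If overriding
          \<open>\<phi>\<close> by \<open>R\<close> falsifies \<open>a\<close>, then the arc from
          \<open>compl a\<close> to \<open>b\<close> puts \<open>b\<close> into
          \<open>R\<close>.\<close>
        then obtain b where b: "C = {a, b}"
          using card \<open>C \<in> F\<close> by (auto simp: card_1_singleton_iff card_2_iff) blast
        then have "b \<in> R" if "compl a \<in> R"
          using closed[OF that, of b] \<open>C \<in> F\<close> by simp
        then show ?thesis using a b by blast
      qed
    qed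
    then show False using mu by (simp add: minimally_unsat_def)
  qed
  then obtain a where "a \<in> R" "compl a \<in> R" by blast
  \<comment> \<open>Contraposing the connection from \<open>x\<close> to \<open>a\<close> leads on
    from \<open>compl a\<close> to \<open>compl x\<close>.\<close>
  then have "x \<rightarrow>\<^sup>*\<^bsub>with_proj (idg F)\<^esub> compl x"
    using idg_reachable_contraposition[of F x a] reachable_trans by (auto simp: R_def)
  then obtain W where W: "vpath W (with_proj (idg F))" "hd W = x" "last W = compl x"
    using reachable_imp_vwalk vwalk_imp_ex_vpath by metis
  then have "W \<noteq> []" by auto
  then have "\<not> regular W"
    using W hd_in_set[of W] last_in_set[of W] by (auto simp: regular_iff)
  then obtain P where P: "prefix P W" "nearly_regular P"
    using ex_nearly_regular_prefix by blast
  then obtain Z where Z: "W = P @ Z" by (auto simp: prefix_def)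
  have "P \<noteq> []" using P by (auto simp: nearly_regular_iff)
  then have "P \<in> nr_paths (idg F) x"
    using W P Z vwalkI_append_l by (auto simp: nr_paths_def vpath_def)
  then have P': "distinct P" "hd P = x" "path_clauses P \<subseteq> F"
    using nr_paths_idg_iff[OF x] by auto
  have "path_clauses P = F"
  proof (rule ccontr)
    assume "path_clauses P \<noteq> F"
    then obtain C where "C \<in> F" "path_clauses P \<subseteq> F - {C}" using P'(3) by blast
    moreover from this(1) have "satisfiable (F - {C})" using mu by (simp add: minimally_unsat_def)
    ultimately have "satisfiable (path_clauses P)"
      unfolding satisfiable_def by (meson subsetD)
    with unsatisfiable_path_clauses P(2) show False by blast
  qed
  with P P' that show thesis by blast
qed

section \<open>Lexicographic choice between the two paths\<close>

lemma lex_less_append_left_rightI: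
  "(a, b) \<in> L - Id \<Longrightarrow> lex_less L (U @ a # V) (U @ b # W)"
  unfolding lex_less_def by (rule lexord_append_left_rightI)

lemma lex_less_irrefl: "\<not> lex_less L P P"
  by (simp add: lex_less_def lexord_irreflexive)

lemma lex_less_asym:
  assumes "antisym L" "lex_less L P Q"
  shows "\<not> lex_less L Q P"
proof -
  have "asym (L - Id)" using assms(1) by (auto intro!: asymI dest: antisymD)
  then show ?thesis using assms(2) lexord_asymmetric unfolding lex_less_def by blast
qed

text \<open>The test of \<open>emit\<close>. A nearly regular path with a unit as last arc is its
  own flip, hence the first disjunct.\<close>

definition selected :: "'v lit rel \<Rightarrow> 'v lit list \<Rightarrow> bool" where
  "selected L P \<longleftrightarrow> is_unit_arc (last (vwalk_arcs P)) \<or> lex_less L P (flip P)"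

lemma concat_map_emit:
  "concat (map (emit L) Ps) = map path_clauses (filter (selected L) Ps)"
  by (induction Ps) (auto simp: emit_def selected_def)

text \<open>Only \<open>P\<close> and \<open>flip P\<close> compete, and \<open>selected\<close>
  makes \<open>P\<close> the least. \<open>F\<close> may be any set above the clauses of
  \<open>P\<close>, so a path found after the removal of unit-clauses is still ranked in the
  original digraph.\<close>

lemma first_path_eq:
  assumes nr: "nearly_regular P" and d: "distinct P" and sel: "selected L P" and "antisym L"
    and sub: "path_clauses P \<subseteq> F" and fu: "first_unit L (path_clauses P) = hd P"
  shows "first_path (idg F) L (path_clauses P) = P"
proof -
  define \<P> where "\<P> = {Q \<in> nr_paths (idg F) (hd P). path_clauses Q = path_clauses P}"
  have "{hd P} \<in> F" using sub by (auto simp: path_clauses_def)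
  note nr_iff = nr_paths_idg_iff[OF this]
  have P: "P \<in> \<P>" using nr d sub by (simp add: \<P>_def nr_iff)
  have least: "Q = P \<or> lex_less L P Q" if "Q \<in> \<P>" for Q
  proof -
    have "Q = P \<or> Q = flip P"
      using path_clauses_eqD[OF nr d, of Q] that by (simp add: \<P>_def nr_iff)
    moreover have "flip P = P" if "is_unit_arc (last (vwalk_arcs P))"
      using nr d by (rule nearly_regular_pathE) (use that in simp)
    ultimately show ?thesis using sel by (auto simp: selected_def)
  qed
  have "(THE R. R \<in> \<P> \<and> (\<forall>Q\<in>\<P>. Q = R \<or> lex_less L R Q)) = P"
  proof (rule the_equality)
    show "P \<in> \<P> \<and> (\<forall>Q\<in>\<P>. Q = P \<or> lex_less L P Q)" using P least by blast
    fix R assume R: "R \<in> \<P> \<and> (\<forall>Q\<in>\<P>. Q = R \<or> lex_less L R Q)"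
    then have "P = R \<or> lex_less L R P" "R = P \<or> lex_less L P R" using P least[of R] by simp_all
    then show "R = P" using lex_less_asym[OF \<open>antisym L\<close>, of P R] by metis
  qed
  then show ?thesis by (simp add: first_path_def fu \<P>_def Let_def)
qed

lemma ex_selected_path:
  assumes nr: "nearly_regular P" and d: "distinct P"
    and "total_on (lits F) L" "set P \<subseteq> lits F"
  shows "\<exists>Q. nearly_regular Q \<and> distinct Q \<and> hd Q = hd P \<and> path_clauses Q = path_clauses P \<and>
    selected L Q"
proof -
  obtain A v B where P: "P = A @ v # B @ [compl v]" and reg: "regular (A @ v # B)"
    and flip: "flip P = A @ v # rev (map compl B) @ [compl v]"
    and unit: "is_unit_arc (last (vwalk_arcs P)) \<longleftrightarrow> B = []"
    using nr d by (rule nearly_regular_pathE)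
  have "selected L P \<or> selected L (flip P)"
  proof (cases "B = []")
    case True
    then show ?thesis using unit by (simp add: selected_def)
  next
    case False
    \<comment> \<open>The vertices after \<open>v\<close> on \<open>P\<close> and on
      \<open>flip P\<close>, where \<open>L\<close> decides; if they were equal, \<open>B\<close>
      would contain a complementary pair.\<close>
    define b a where "b = hd B" and "a = compl (last B)"
    from False obtain B' where b: "B = b # B'" unfolding b_def by (metis list.collapse)
    from False obtain B'' where "B = B'' @ [compl a]"
      unfolding a_def by (metis append_butlast_last_id compl_compl)
    then have a: "rev (map compl B) = a # rev (map compl B'')" by simp
    have P_b: "P = (A @ [v]) @ b # B' @ [compl v]" by (simp add: P b)
    have flip_a: "flip P = (A @ [v]) @ a # rev (map compl B'') @ [compl v]" by (simp add: flip a)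
    have in_B: "b \<in> set B" "compl a \<in> set B" using False by (simp_all add: a_def b_def)
    then have "b \<noteq> a" using reg by (auto simp: regular_iff)
    moreover have "b \<in> lits F" "a \<in> lits F"
      using in_B assms(4) P by (auto simp: lits_def subset_iff)
    ultimately have "(b, a) \<in> L - Id \<or> (a, b) \<in> L - Id"
      using assms(3) by (auto simp: total_on_def)
    then have "lex_less L P (flip P) \<or> lex_less L (flip P) P"
      using flip_a P_b by (metis lex_less_append_left_rightI)
    then show ?thesis using nearly_regular_flip(5)[OF nr d] by (auto simp: selected_def)
  qed
  then show ?thesis using nearly_regular_flip[OF nr d] nr d by blast
qed

section \<open>Ordered listing of finite sets\<close>

lemma linear_order_on_Restr_subset:
  assumes "linear_order_on A (Restr L A)" "B \<subseteq> A"
  shows "linear_order_on B (Restr L B)"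
  using assms
  by (simp add: order_on_defs refl_on_def total_on_def antisym_def trans_def subset_iff) blast

text \<open>Counting the elements of \<open>A\<close> below a given one embeds the order into the
  natural numbers, where sorted lists exist and are unique. Distinctness then makes the order
  strict.\<close>

lemma ordered_list:
  assumes "finite A" and lin: "linear_order_on A (Restr L A)"
  shows "set (ordered_list L A) = A" "sorted_wrt (\<lambda>a b. (a, b) \<in> L - Id) (ordered_list L A)"
proof -
  define f where "f a = card {b \<in> A. (b, a) \<in> L}" for a
  have refl: "(a, a) \<in> L" if "a \<in> A" for a
    using lin that by (auto simp: order_on_defs refl_on_def)
  have less: "f a < f b" if "a \<in> A" "b \<in> A" "(a, b) \<in> L" "a \<noteq> b" for a b
    unfolding f_def
  proof (rule psubset_card_mono)
    have "(b, a) \<notin> L"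
      using lin that antisymD[of "Restr L A" a b] by (auto simp: order_on_defs)
    moreover have "(c, b) \<in> L" if "c \<in> A" "(c, a) \<in> L" for c
      using lin that \<open>a \<in> A\<close> \<open>b \<in> A\<close> \<open>(a, b) \<in> L\<close> transD[of "Restr L A" c a b]
      by (auto simp: order_on_defs)
    ultimately show "{c \<in> A. (c, a) \<in> L} \<subset> {c \<in> A. (c, b) \<in> L}"
      using refl[OF \<open>b \<in> A\<close>] \<open>b \<in> A\<close> by blast
  qed (use assms in simp)
  have total: "(a, b) \<in> L \<or> (b, a) \<in> L" if "a \<in> A" "b \<in> A" for a b
    using lin that refl by (cases "a = b") (auto simp: order_on_defs total_on_def)
  have le_iff: "f a \<le> f b \<longleftrightarrow> (a, b) \<in> L" if "a \<in> A" "b \<in> A" for a b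
    using total less that refl by (metis leD less_imp_le order_refl)
  have inj: "inj_on f A"
    using total less by (metis inj_onI less_irrefl)
  have strict: "sorted_wrt (\<lambda>a b. (a, b) \<in> L - Id) xs"
    if "distinct xs" "sorted_wrt (\<lambda>a b. (a, b) \<in> L) xs" for xs
    using that by (induction xs) auto
  let ?S = "\<lambda>xs. distinct xs \<and> set xs = A \<and> sorted_wrt (\<lambda>a b. (a, b) \<in> L) xs"
  have S_iff: "?S xs \<longleftrightarrow> distinct xs \<and> set xs = A \<and> sorted (map f xs)" for xs
    by (auto simp: sorted_map le_iff intro: sorted_wrt_mono_rel[rotated])
  define xs where "xs = map (the_inv_into A f) (sorted_list_of_set (f ` A))"
  have "map f xs = sorted_list_of_set (f ` A)"
    unfolding xs_def map_map using assms(1) inj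
    by (intro map_idI) (auto simp: the_inv_into_f_f)
  moreover have "distinct xs" "set xs = A"
    unfolding xs_def using assms(1) inj
    by (auto simp: distinct_map the_inv_into_f_f image_image inj_on_the_inv_into)
  ultimately have "?S xs" unfolding S_iff by simp
  then have "?S (ordered_list L A)"
    unfolding ordered_list_def
  proof (rule theI)
    fix ys assume "?S ys"
    have "map f ys = map f xs"
      using \<open>?S xs\<close> \<open>?S ys\<close> inj unfolding S_iff
      by (intro sorted_distinct_set_unique) (auto simp: distinct_map)
    moreover have "inj_on f (set ys \<union> set xs)" using inj \<open>?S xs\<close> \<open>?S ys\<close> by simp
    ultimately show "ys = xs" by (simp add: inj_on_map_eq_map)
  qed
  then show "set (ordered_list L A) = A"
    "sorted_wrt (\<lambda>a b. (a, b) \<in> L - Id) (ordered_list L A)"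
    using strict by blast+
qed

section \<open>Depth-first search for nearly regular paths\<close>

text \<open>The reachability test of DFS thus discards no vertex lying on a nearly regular path.
  From its end \<open>compl v\<close>, \<open>Q\<close> is continued along the contraposition of
  \<open>A @ [v]\<close> to \<open>compl x\<close>; the resulting \<open>W\<close> is still
  distinct, so its part from \<open>z\<close> on avoids \<open>R\<close>.\<close>

lemma nr_path_reaches:
  assumes "pair_wf_digraph G" and skew: "\<And>a b. (a, b) \<in> parcs G \<Longrightarrow> (compl b, compl a) \<in> parcs G"
    and Q: "Q \<in> nr_paths G x" and split: "Q = R @ z # S"
  shows "z \<rightarrow>\<^sup>*\<^bsub>with_proj G \<restriction> (pverts G - set R)\<^esub> compl x"
proof -
  interpret pair_wf_digraph G by (rule assms(1))
  let ?H = "with_proj G \<restriction> (pverts G - set R)"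
  interpret H: wf_digraph ?H by (rule wellformed_induce_subgraph)
  have nr: "nearly_regular Q" "distinct Q" and vw: "vwalk Q (with_proj G)" and x: "hd Q = x"
    using Q by (auto simp: nr_paths_def vpath_def)
  obtain A v B where QA: "Q = A @ v # B @ [compl v]" and reg: "regular (A @ v # B)"
    using nr by (rule nearly_regular_pathE)
  define W where "W = Q \<oplus> contraposition (A @ [v])"
  have W: "W = Q @ rev (map compl A)"
    by (simp add: W_def vwalk_join_def contraposition_def)
  have "joinable Q (contraposition (A @ [v]))"
    using QA by (simp add: joinable_def contraposition_def)
  then have W_arcs: "set (vwalk_arcs W) =
    set (vwalk_arcs Q) \<union> set (vwalk_arcs (contraposition (A @ [v])))"
    unfolding W_def by (simp add: vwalk_join_arcs)
  have "Q = (A @ [v]) @ B @ [compl v]" using QA by simp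
  then have "set (vwalk_arcs (A @ [v])) \<subseteq> set (vwalk_arcs Q)"
    by (metis set_vwalk_arcs_append1)
  moreover have Q_arcs: "set (vwalk_arcs Q) \<subseteq> parcs G" using vw by (simp add: vwalk_def)
  ultimately have "(compl b, compl a) \<in> parcs G" if "(a, b) \<in> set (vwalk_arcs (A @ [v]))" for a b
    by (intro skew) (use that in blast)
  then have "set (vwalk_arcs (contraposition (A @ [v]))) \<subseteq> parcs G"
    by (auto simp: set_vwalk_arcs_contraposition)
  with W_arcs Q_arcs have arcs: "set (vwalk_arcs W) \<subseteq> parcs G" by blast
  have verts: "set W \<subseteq> pverts G"
  proof
    fix c assume "c \<in> set W"
    then obtain U V where UV: "W = U @ c # V" by (meson split_list)
    show "c \<in> pverts G"
    proof (cases U rule: rev_cases)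
      case Nil
      then show ?thesis using UV vw unfolding W vwalk_def by (cases Q) auto
    next
      case (snoc U' d)
      then have "(d, c) \<in> set (vwalk_arcs W)" using UV by (auto simp: in_vwalk_arcs_iff)
      then show ?thesis using arcs in_arcsD2 by blast
    qed
  qed
  \<comment> \<open>A complemented vertex of \<open>A\<close> is not in \<open>A @ v # B\<close> by
    regularity, and differs from \<open>compl v\<close> since \<open>v\<close> is not in
    \<open>A\<close>.\<close>
  have distinct: "distinct W"
    using nr(2) reg unfolding W QA
    by (auto simp: distinct_map inj_on_def regular_iff in_compl_image_iff)
  have last: "last W = compl x"
    using x unfolding W QA by (cases A) simp_all
  define T where "T = z # S @ rev (map compl A)"
  have WT: "W = R @ T" by (simp add: W split T_def)
  have "vwalk T ?H"
  proof (rule vwalkI)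
    show "set T \<subseteq> verts ?H" using verts distinct WT by auto
    moreover have "set (vwalk_arcs T) \<subseteq> parcs G"
      using arcs set_vwalk_arcs_append2[of T R] WT by blast
    ultimately show "set (vwalk_arcs T) \<subseteq> arcs_ends ?H"
      using arcs_in_vwalk_arcs[of _ T]
      by (fastforce simp: arcs_ends_def arc_to_ends_def image_iff)
    show "T \<noteq> []" by (simp add: T_def)
  qed
  then have "hd T \<rightarrow>\<^sup>*\<^bsub>?H\<^esub> last T" by (rule H.vwalk_imp_reachable)
  then show ?thesis using last WT by (simp add: T_def)
qed

lemma concat_map_concat: "concat (map g (concat xss)) = concat (map (\<lambda>xs. concat (map g xs)) xss)"
  by (induction xss) auto

lemma sorted_wrt_concat_map:
  assumes "\<And>z. z \<in> set zs \<Longrightarrow> sorted_wrt r (f z)"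
    and "sorted_wrt (\<lambda>z z'. \<forall>p\<in>set (f z). \<forall>q\<in>set (f z'). r p q) zs"
  shows "sorted_wrt r (concat (map f zs))"
  using assms by (induction zs) (auto simp: sorted_wrt_append)

text \<open>\<open>Ps\<close> lists the paths handed to OUTPUT: order and completeness are settled
  for paths, before \<open>emit\<close> drops some of them. The order comes from the common prefix
  \<open>P @ [y]\<close> followed by ordered successors.\<close>

lemma (in ordered_literal_digraph) dfs_eq:
  assumes skew: "\<And>a b. (a, b) \<in> parcs G \<Longrightarrow> (compl b, compl a) \<in> parcs G"
    and "vpath (P @ [y]) (with_proj G)" "regular P" "hd (P @ [y]) = x"
  shows "\<exists>Ps. dfs x P y = concat (map (emit L) Ps) \<and> sorted_wrt (lex_less L) Ps \<and>
    set Ps = {Q \<in> nr_paths G x. prefix (P @ [y]) Q}"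
  using assms(2-)
proof (induction x P y rule: dfs.induct)
  case (1 x P y)
  show ?case
  proof (cases "regular (P @ [y])")
    case False
    then have nr: "nearly_regular (P @ [y])" using 1(3) by (simp add: nearly_regular_iff)
    then have "{Q \<in> nr_paths G x. prefix (P @ [y]) Q} = {P @ [y]}"
      using nearly_regular_prefix_eq[OF nr] 1 by (auto simp: nr_paths_def)
    then show ?thesis
      using False by (intro exI[of _ "[P @ [y]]"]) (simp add: dfs.simps[of x P y])
  next
    case True
    let ?R = "dfs_successors G x (P @ [y]) y"
    let ?zs = "ordered_list L ?R"
    have "?R \<subseteq> pverts G" by (auto simp: dfs_successors_def Let_def)
    then have zs: "set ?zs = ?R" "sorted_wrt (\<lambda>a b. (a, b) \<in> L - Id) ?zs"
      using ordered_list[of ?R L] linear_order_on_Restr_subset[OF linear]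
        finite_subset[OF _ pair_finite_verts] by blast+
    define D where "D z Ps \<longleftrightarrow> dfs x (P @ [y]) z = concat (map (emit L) Ps) \<and>
      sorted_wrt (lex_less L) Ps \<and> set Ps = {Q \<in> nr_paths G x. prefix ((P @ [y]) @ [z]) Q}"
      for z Ps
    have "\<exists>Ps. D z Ps" if z: "z \<in> set ?zs" for z
      unfolding D_def
    proof (rule 1(1))
      have "z \<in> pverts G - set (P @ [y])" "(y, z) \<in> parcs G"
        using z unfolding zs(1) by (auto simp: dfs_successors_def Let_def)
      moreover have "set (vwalk_arcs ((P @ [y]) @ [z])) = insert (y, z) (set (vwalk_arcs (P @ [y])))"
        by (subst set_vwalk_arcs_snoc) simp_all
      ultimately show "vpath ((P @ [y]) @ [z]) (with_proj G)"
        using 1(2) by (auto simp: vpath_def vwalk_def)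
      show "hd ((P @ [y]) @ [z]) = x" using 1(4) by (cases P) auto
    qed (use True z in simp_all)
    then obtain f where "\<And>z. z \<in> set ?zs \<Longrightarrow> D z (f z)" by metis
    then have f: "\<And>z. z \<in> set ?zs \<Longrightarrow> dfs x (P @ [y]) z = concat (map (emit L) (f z))"
      "\<And>z. z \<in> set ?zs \<Longrightarrow> sorted_wrt (lex_less L) (f z)"
      "\<And>z. z \<in> set ?zs \<Longrightarrow> set (f z) = {Q \<in> nr_paths G x. prefix ((P @ [y]) @ [z]) Q}"
      unfolding D_def by blast+
    have "dfs x P y = concat (map (emit L) (concat (map f ?zs)))"
      using True f(1) by (simp add: dfs.simps[of x P y] concat_map_concat o_def cong: map_cong)
    moreover have "sorted_wrt (lex_less L) (concat (map f ?zs))"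
    proof (rule sorted_wrt_concat_map)
      show "sorted_wrt (\<lambda>z z'. \<forall>p\<in>set (f z). \<forall>q\<in>set (f z'). lex_less L p q) ?zs"
        using _ zs(2)
      proof (rule sorted_wrt_mono_rel)
        fix z z' assume "z \<in> set ?zs" "z' \<in> set ?zs" "(z, z') \<in> L - Id"
        then show "\<forall>p\<in>set (f z). \<forall>q\<in>set (f z'). lex_less L p q"
          using lex_less_append_left_rightI[of z z' L "P @ [y]"] by (auto simp: f(3) prefix_def)
      qed
    qed (rule f(2))
    moreover have "set (concat (map f ?zs)) = {Q \<in> nr_paths G x. prefix (P @ [y]) Q}"
    proof -
      \<comment> \<open>Since \<open>P @ [y]\<close> is regular, \<open>Q\<close> goes on to some
        \<open>z\<close>, which passes the reachability test by
        \<open>nr_path_reaches\<close>.\<close>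
      have "\<exists>z\<in>?R. prefix ((P @ [y]) @ [z]) Q" if Q: "Q \<in> nr_paths G x" "prefix (P @ [y]) Q" for Q
      proof -
        have "Q \<noteq> P @ [y]" using Q(1) True by (auto simp: nr_paths_def nearly_regular_iff)
        then obtain z S where S: "Q = (P @ [y]) @ z # S"
          using Q(2) by (metis strict_prefixI strict_prefixE')
        have "vpath Q (with_proj G)" using Q(1) by (simp add: nr_paths_def)
        moreover have "(y, z) \<in> set (vwalk_arcs Q)" using S by (auto simp: in_vwalk_arcs_iff)
        ultimately have "(y, z) \<in> parcs G" "z \<in> pverts G - set (P @ [y])"
          using S by (auto simp: vpath_def vwalk_def)
        then have "z \<in> ?R"
          using nr_path_reaches[OF pair_wf_digraph_axioms skew Q(1) S] by (simp add: dfs_successors_def Let_def)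
        then show ?thesis using S by (auto simp: prefix_def)
      qed
      moreover have "prefix (P @ [y]) Q" if "prefix ((P @ [y]) @ [z]) Q" for z Q
        using that by (rule append_prefixD)
      moreover have "set (concat (map f ?zs)) =
        (\<Union>z\<in>?R. {Q \<in> nr_paths G x. prefix ((P @ [y]) @ [z]) Q})"
        using f(3) zs(1) by simp
      ultimately show ?thesis by blast
    qed
    ultimately show ?thesis by blast
  qed
qed

section \<open>The loop over the unit-clauses\<close>

lemma enum_unit_eq:
  assumes "ordered_literal_digraph (idg F) L" "{x} \<in> F"
  shows "\<exists>Ps. enum_unit L F x = concat (map (emit L) Ps) \<and> sorted_wrt (lex_less L) Ps \<and>
    set Ps = nr_paths (idg F) x"
proof -
  interpret ordered_literal_digraph "idg F" L by (rule assms(1))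
  show ?thesis
  proof (cases "x \<rightarrow>\<^sup>*\<^bsub>with_proj (idg F)\<^esub> compl x")
    case True
    have "x \<in> lits F" using assms(2) by (auto simp: lits_def vars_def)
    then obtain Ps where Ps: "dfs x [] x = concat (map (emit L) Ps)" "sorted_wrt (lex_less L) Ps"
      "set Ps = {Q \<in> nr_paths (idg F) x. prefix [x] Q}"
      using dfs_eq[OF idg_skew_symmetric, of "[]" x x] vpath_self[of x "with_proj (idg F)"]
      by (auto simp: regular_iff)
    have "prefix [x] Q" if "Q \<in> nr_paths (idg F) x" for Q
      using that by (cases Q) (auto simp: nr_paths_def vpath_def vwalk_def)
    with Ps True show ?thesis by (auto simp: enum_unit_def)
  next
    case False
    \<comment> \<open>By \<open>nr_path_reaches\<close> with an empty prefix, such a path would make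
      \<open>compl x\<close> reachable from \<open>x\<close>.\<close>
    have "Q \<notin> nr_paths (idg F) x" for Q
    proof
      assume Q: "Q \<in> nr_paths (idg F) x"
      then have "Q = [] @ x # tl Q"
        by (cases Q) (auto simp: nr_paths_def vpath_def vwalk_def)
      from nr_path_reaches[OF pair_wf_digraph_axioms idg_skew_symmetric Q this] False show False
        by (auto dest: reachable_induce_subgraphD)
    qed
    with False show ?thesis by (intro exI[of _ "[]"]) (auto simp: enum_unit_def)
  qed
qed

text \<open>The rounds work on shrinking sets \<open>F\<close>, whereas the order refers to the
  fixed \<open>F0\<close>. The last conjunct is the invariant that puts the rounds in order: later
  paths start with a later unit, so the first vertex already decides.\<close>

lemma enum_loop_correct:
  assumes F0: "is_clause_set F0" "\<forall>C\<in>F0. card C = 1 \<or> card C = 2" "linear_order_on (lits F0) L"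
    and "F \<subseteq> F0" "set xs = {x. {x} \<in> F}" "sorted_wrt (\<lambda>a b. (a, b) \<in> L - Id) xs"
  shows "set (enum_loop L F xs) = {F'. F' \<subseteq> F \<and> minimally_unsat F' \<and> (\<exists>z. {z} \<in> F')} \<and>
    sorted_wrt (pathlex_less (idg F0) L) (enum_loop L F xs) \<and>
    (\<forall>F'\<in>set (enum_loop L F xs).
      \<exists>x\<in>set xs. \<exists>P. first_path (idg F0) L F' = x # P)"
  using assms(4-)
proof (induction xs arbitrary: F)
  case Nil
  then show ?case by auto
next
  case (Cons x xs)
  have anti: "antisym L" and tot: "total_on (lits F0) L" and rfl: "refl_on (lits F0) L"
    using F0(3) by (auto simp: order_on_defs)
  have x: "{x} \<in> F" using Cons.prems by auto
  \<comment> \<open>So \<open>x\<close> is the \<open>first_unit\<close> of every set printed in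
    this round.\<close>
  have min: "(x, z) \<in> L" if "{z} \<in> F" for z
  proof -
    have "x \<in> lits F0" using x Cons.prems(1) by (auto simp: lits_def vars_def)
    moreover have "z \<in> set (x # xs)" using that Cons.prems by auto
    ultimately show ?thesis using Cons.prems(3) rfl by (auto simp: refl_on_def)
  qed
  obtain Ps where Ps: "enum_unit L F x = concat (map (emit L) Ps)" "sorted_wrt (lex_less L) Ps"
    "set Ps = nr_paths (idg F) x"
    using enum_unit_eq ordered_literal_digraph_idg[OF F0(1,3) Cons.prems(1)] x by blast
  let ?Ps = "filter (selected L) Ps"
  have unit: "enum_unit L F x = map path_clauses ?Ps"
    by (simp add: Ps(1) concat_map_emit)
  have fp: "first_path (idg F0) L (path_clauses P) = P" "hd P = x" "P \<noteq> []"
    "minimally_unsat (path_clauses P)" "path_clauses P \<subseteq> F"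
    if "P \<in> set ?Ps" for P
  proof -
    have P: "nearly_regular P" "distinct P" "hd P = x" "path_clauses P \<subseteq> F" "selected L P"
      using that Ps(3) nr_paths_idg_iff[OF x] by auto
    have "first_unit L (path_clauses P) = x"
      unfolding first_unit_def
    proof (rule the_equality)
      have "{x} \<in> path_clauses P" using P by (simp add: path_clauses_def)
      then show "{x} \<in> path_clauses P \<and> (\<forall>z'. {z'} \<in> path_clauses P \<longrightarrow> (x, z') \<in> L)"
        using min P(4) by blast
      fix z assume "{z} \<in> path_clauses P \<and> (\<forall>z'. {z'} \<in> path_clauses P \<longrightarrow> (z, z') \<in> L)"
      then show "z = x"
        using \<open>{x} \<in> path_clauses P\<close> min P(4) antisymD[OF anti] by blast
    qed
    then show "first_path (idg F0) L (path_clauses P) = P"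
      using P anti Cons.prems(1) by (intro first_path_eq) auto
    show "minimally_unsat (path_clauses P)" using P by (intro minimally_unsat_path_clauses)
    show "hd P = x" "P \<noteq> []" "path_clauses P \<subseteq> F"
      using P by (auto simp: nearly_regular_iff)
  qed
  have set_unit: "set (enum_unit L F x) = {F'. F' \<subseteq> F \<and> minimally_unsat F' \<and> {x} \<in> F'}"
  proof (intro set_eqI iffI)
    fix F' assume "F' \<in> set (enum_unit L F x)"
    then obtain P where "P \<in> set ?Ps" "F' = path_clauses P" unfolding unit by auto
    then show "F' \<in> {F'. F' \<subseteq> F \<and> minimally_unsat F' \<and> {x} \<in> F'}"
      using fp[of P] by (auto simp: path_clauses_def)
  next
    fix F' assume "F' \<in> {F'. F' \<subseteq> F \<and> minimally_unsat F' \<and> {x} \<in> F'}"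
    then have F': "F' \<subseteq> F" "minimally_unsat F'" "{x} \<in> F'" by auto
    then have "\<forall>C\<in>F'. card C = 1 \<or> card C = 2" using F0(2) Cons.prems(1) by blast
    with F' obtain P where P: "nearly_regular P" "distinct P" "hd P = x" "path_clauses P = F'"
      by (metis minimally_unsat_imp_path)
    then have "P \<in> nr_paths (idg F) x" using F' nr_paths_idg_iff[OF x] by auto
    then have "set P \<subseteq> lits F" by (auto simp: nr_paths_def vpath_def vwalk_def)
    also have "\<dots> \<subseteq> lits F0" using Cons.prems(1) by (auto simp: lits_def vars_def)
    \<comment> \<open>\<open>P\<close> may be the larger of the two paths for \<open>F'\<close>; the
      selected one is responsible for the output.\<close>
    finally obtain Q where Q: "nearly_regular Q" "distinct Q" "hd Q = x" "path_clauses Q = F'"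
      "selected L Q"
      using ex_selected_path[OF P(1,2) tot] P by auto
    then have "Q \<in> set ?Ps" using Ps(3) F' nr_paths_idg_iff[OF x] by auto
    then show "F' \<in> set (enum_unit L F x)" unfolding unit using Q(4) by auto
  qed
  have "x \<notin> set xs" using Cons.prems(3) by auto
  then have "set xs = {y. {y} \<in> F - {{x}}}" using Cons.prems(2) by auto
  from Cons.IH[OF _ this]
  have IH: "set (enum_loop L (F - {{x}}) xs) =
      {F'. F' \<subseteq> F - {{x}} \<and> minimally_unsat F' \<and> (\<exists>z. {z} \<in> F')}"
    "sorted_wrt (pathlex_less (idg F0) L) (enum_loop L (F - {{x}}) xs)"
    "\<And>F'. F' \<in> set (enum_loop L (F - {{x}}) xs) \<Longrightarrow>
      \<exists>x\<in>set xs. \<exists>P. first_path (idg F0) L F' = x # P"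
    using Cons.prems(1,3) by auto
  \<comment> \<open>A subset of \<open>F\<close> either contains \<open>{x}\<close> and belongs to
    this round, or it is a subset of \<open>F - {{x}}\<close>.\<close>
  have "set (enum_loop L F (x # xs)) = {F'. F' \<subseteq> F \<and> minimally_unsat F' \<and> (\<exists>z. {z} \<in> F')}"
    by (auto simp: set_unit IH(1))
  moreover have "sorted_wrt (pathlex_less (idg F0) L) (enum_loop L F (x # xs))"
    unfolding enum_loop.simps sorted_wrt_append
  proof (intro conjI ballI IH(2))
    have "sorted_wrt (lex_less L) ?Ps" using Ps(2) by (rule sorted_wrt_filter)
    then show "sorted_wrt (pathlex_less (idg F0) L) (enum_unit L F x)"
      unfolding unit sorted_wrt_map
      by (rule sorted_wrt_mono_rel[rotated]) (simp add: pathlex_less_def fp(1))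
    fix F' F'' assume *: "F' \<in> set (enum_unit L F x)" "F'' \<in> set (enum_loop L (F - {{x}}) xs)"
    from *(1) obtain P where P: "P \<in> set ?Ps" "F' = path_clauses P" unfolding unit by auto
    then obtain P' where "first_path (idg F0) L F' = x # P'"
      using fp[of P] by (metis list.collapse)
    moreover obtain x' P'' where "x' \<in> set xs" "first_path (idg F0) L F'' = x' # P''"
      using IH(3)[OF *(2)] by blast
    moreover from this have "(x, x') \<in> L - Id" using Cons.prems(3) by simp
    ultimately show "pathlex_less (idg F0) L F' F''"
      by (simp add: pathlex_less_def lex_less_def)
  qed
  moreover have "\<exists>x'\<in>set (x # xs). \<exists>P. first_path (idg F0) L F' = x' # P"
    if F': "F' \<in> set (enum_loop L F (x # xs))" for F'
  proof (cases "F' \<in> set (enum_unit L F x)")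
    case True
    then obtain P where "P \<in> set ?Ps" "F' = path_clauses P" unfolding unit by auto
    then have "first_path (idg F0) L F' = x # tl P" using fp[of P] by (cases P) auto
    then show ?thesis by auto
  next
    case False
    then show ?thesis using F' IH(3)[of F'] by auto
  qed
  ultimately show ?case by blast
qed

lemma sorted_wrt_imp_distinct:
  assumes "\<And>x. \<not> r x x" "sorted_wrt r xs"
  shows "distinct xs"
  using assms(2) by (induction xs) (auto simp: assms(1))

theorem theorem7p7:
  fixes F :: "'v lit set set" and L :: "'v lit rel"
  assumes "is_clause_set F"
    and "\<forall>C\<in>F. card C = 1 \<or> card C = 2"
    and "linear_order_on (lits F) L"
  shows "set (enum_all L F) = {F'. F' \<subseteq> F \<and> minimally_unsat F' \<and> (\<exists>z. {z} \<in> F')} \<and>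
    distinct (enum_all L F) \<and>
    sorted_wrt (pathlex_less (idg F) L) (enum_all L F)"
proof -
  let ?U = "{x. {x} \<in> F}"
  have "finite F" using assms(1) by (simp add: is_clause_set_def)
  then have "finite ((\<lambda>x. {x}) -` F)" by (rule finite_vimageI) simp
  then have "finite ?U" by (simp add: vimage_def)
  moreover have "?U \<subseteq> lits F" by (auto simp: lits_def vars_def)
  moreover have "Restr L (lits F) = L" using assms(3) by (auto simp: order_on_defs)
  ultimately have U: "set (ordered_list L ?U) = ?U"
    "sorted_wrt (\<lambda>a b. (a, b) \<in> L - Id) (ordered_list L ?U)"
    using ordered_list linear_order_on_Restr_subset assms(3) by metis+
  note correct = enum_loop_correct[OF assms subset_refl U]
  \<comment> \<open>\<open>pathlex_less\<close> inherits irreflexivity from \<open>lex_less\<close>,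
    so sortedness already rules out repetitions.\<close>
  moreover have "distinct (enum_all L F)"
    using correct sorted_wrt_imp_distinct[of "pathlex_less (idg F) L"]
    by (simp add: enum_all_def pathlex_less_def lex_less_irrefl)
  ultimately show ?thesis by (simp add: enum_all_def)
qed

end
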